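(* Let $p$ be an odd prime, let $\mathbb G=\mathbb Z_p$, and suppose that $\mathcal S\subset\mathbb G$ is a $(p,m,\lambda,\mu)$-Gaussian difference set for $\mathbb G$. Let $\mathcal F=\{f_g\}_{g\in\mathbb G}$ be the $\mathbb G$-harmonic frame for $\mathbb C^m$ generated by $\mathcal S$. Then one of the following holds: (1) $p\equiv 3 \pmod 4$, $\mathcal S$ is a $(p,m,\lambda)$-difference set for $\mathbb G$, and $\mathcal F$ is an equiangular tight frame; (2) $p\equiv 1\pmod 4$, $\mathcal S$ is a $(p,m,\lambda)$-difference set for $\mathbb G$, and $\mathcal F$ is an equiangular tight frame; (3) $p\equiv1\pmod 4$ and $\mathcal F$ is a biangular tight frame with frame angles $\alpha_1,\alpha_2$ and frame angle multiplicities $\tau_1,\tau_2$, where $$\alpha_1,\alpha_2=\frac1m\sqrt{(m-\lambda)+(\lambda-\mu)\left(\frac{1\pm\sqrt p}{2}\right)}$$ and $\tau_1=\tau_2=\frac{p-1}{2}$.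
   Context: Harmonic frame: for a set $\mathcal S=\{g_1,\dots,g_m\}$ of $m\ge1$ distinct elements of $\mathbb Z_p$, the $\mathbb Z_p$-harmonic frame generated by $\mathcal S$ is the family $\{f_x\}_{x\in\mathbb Z_p}\subset\mathbb C^m$ with $f_x=\frac1{\sqrt m}\left(e^{2\pi i g_jx/p}\right)_{j=1}^m$. A family $\{f_x\}$ in $\mathbb C^m$ is a tight frame if $\sum_x f_xf_x^*=aI_m$ for some $a>0$. The frame angles of a unit-norm frame are the elements of $\{|\langle f_x,f_y\rangle|: x\neq y\}$ (indices distinct); the frame is equiangular (respectively biangular) if this set has exactly one (respectively exactly two) elements. The frame has multiplicity $\tau_l$ for the frame angle $\alpha_l$ if for every index $x$ there are exactly $\tau_l$ indices $y\ne x$ with $|\langle f_x,f_y\rangle|=\alpha_l$. Let $R^{(2)}_p=\{z^2: z\in\mathbb Z_p^*\}$. An $m$-element subset $\mathcal S=\{g_1,\dots,g_m\}\subset\mathbb Z_p$ is a $(p,m,\lambda,\mu)$-Gaussian difference set for $\mathbb Z_p$, where $\lambda,\mu$ are nonnegative integers, if every element of $R^{(2)}_p$ can be written as $g_a-g_b$ in exactly $\lambda$ ways (number of ordered pairs $(a,b)$) and every element of $\mathbb Z_p\setminus(R^{(2)}_p\cup\{0\})$ can be written as $g_a-g_b$ in exactly $\mu$ ways. It is a $(p,m,\lambda)$-difference set if every nonzero element of $\mathbb Z_p$ can be written as $g_a-g_b$ in exactly $\lambda$ ways. *)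

theory Defs
  imports "HOL-Analysis.Analysis" "HOL-Number_Theory.Residues"
begin

section \<open>Finite frames for complex coordinate space\<close>

text \<open>
  A family of vectors in complex m-space is a function on an index set \<open>X\<close> with values in
  \<open>complex^'m\<close>, where \<open>m = CARD('m)\<close>. The library's inner product on \<open>complex^'m\<close> is the real
  one, so the Hermitian product is introduced separately.
\<close>

definition herm_prod :: "complex^'m \<Rightarrow> complex^'m \<Rightarrow> complex" where
  "herm_prod u v = (\<Sum>j\<in>UNIV. u $ j * cnj (v $ j))"

text \<open>The rank one matrix \<open>u u\<^sup>*\<close>.\<close>

definition outer_prod :: "complex^'m \<Rightarrow> complex^'m^'m" where
  "outer_prod u = (\<chi> i j. u $ i * cnj (u $ j))"

text \<open>In the library, \<open>mat c\<close> is \<open>c\<close> times the identity matrix.\<close>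

definition tight_frame :: "'x set \<Rightarrow> ('x \<Rightarrow> complex^'m) \<Rightarrow> bool" where
  "tight_frame X f \<longleftrightarrow>
     (\<exists>a::real. a > 0 \<and> (\<Sum>x\<in>X. outer_prod (f x)) = mat (complex_of_real a))"

definition unit_norm :: "'x set \<Rightarrow> ('x \<Rightarrow> complex^'m) \<Rightarrow> bool" where
  "unit_norm X f \<longleftrightarrow> (\<forall>x\<in>X. norm (f x) = 1)"

definition frame_angles :: "'x set \<Rightarrow> ('x \<Rightarrow> complex^'m) \<Rightarrow> real set" where
  "frame_angles X f = {cmod (herm_prod (f x) (f y)) | x y. x \<in> X \<and> y \<in> X \<and> x \<noteq> y}"

text \<open>
  Frame angles are only considered for unit-norm families, so this is part of being equiangular
  or biangular.
\<close>

definition equiangular :: "'x set \<Rightarrow> ('x \<Rightarrow> complex^'m) \<Rightarrow> bool" where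
  "equiangular X f \<longleftrightarrow> unit_norm X f \<and> card (frame_angles X f) = 1"

definition biangular :: "'x set \<Rightarrow> ('x \<Rightarrow> complex^'m) \<Rightarrow> bool" where
  "biangular X f \<longleftrightarrow> unit_norm X f \<and> card (frame_angles X f) = 2"

definition has_angle_multiplicity ::
    "'x set \<Rightarrow> ('x \<Rightarrow> complex^'m) \<Rightarrow> real \<Rightarrow> nat \<Rightarrow> bool" where
  "has_angle_multiplicity X f \<alpha> \<tau> \<longleftrightarrow>
     \<alpha> \<in> frame_angles X f \<and>
     (\<forall>x\<in>X. card {y \<in> X. y \<noteq> x \<and> cmod (herm_prod (f x) (f y)) = \<alpha>} = \<tau>)"


section \<open>The group of residues, difference sets and harmonic frames\<close>

text \<open>
  The integers modulo \<open>p\<close> are the library's residue ring, with carrier \<open>{0..p - 1}\<close>.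
\<close>

abbreviation Zmod :: "nat \<Rightarrow> int ring" where
  "Zmod p \<equiv> residue_ring (int p)"

definition nonzero_squares :: "nat \<Rightarrow> int set" where
  "nonzero_squares p = {z [^]\<^bsub>Zmod p\<^esub> (2::nat) | z. z \<in> Units (Zmod p)}"

definition diff_count :: "nat \<Rightarrow> int set \<Rightarrow> int \<Rightarrow> nat" where
  "diff_count p S d = card {(a, b). a \<in> S \<and> b \<in> S \<and> a \<ominus>\<^bsub>Zmod p\<^esub> b = d}"

definition difference_set :: "nat \<Rightarrow> nat \<Rightarrow> nat \<Rightarrow> int set \<Rightarrow> bool" where
  "difference_set p m l S \<longleftrightarrow>
     S \<subseteq> carrier (Zmod p) \<and> card S = m \<and>
     (\<forall>d \<in> carrier (Zmod p) - {\<zero>\<^bsub>Zmod p\<^esub>}. diff_count p S d = l)"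

definition gaussian_difference_set ::
    "nat \<Rightarrow> nat \<Rightarrow> nat \<Rightarrow> nat \<Rightarrow> int set \<Rightarrow> bool" where
  "gaussian_difference_set p m l \<mu> S \<longleftrightarrow>
     S \<subseteq> carrier (Zmod p) \<and> card S = m \<and>
     (\<forall>d \<in> nonzero_squares p. diff_count p S d = l) \<and>
     (\<forall>d \<in> carrier (Zmod p) - (nonzero_squares p \<union> {\<zero>\<^bsub>Zmod p\<^esub>}). diff_count p S d = \<mu>)"

text \<open>
  The argument \<open>g\<close> lists the generating set \<open>S = {g\<^sub>1, \<dots>, g\<^sub>m}\<close>, one element for each coordinate;
  it is meant to be a bijection from \<open>'m\<close> to \<open>S\<close>.
\<close>

definition harmonic_frame :: "nat \<Rightarrow> ('m::finite \<Rightarrow> int) \<Rightarrow> int \<Rightarrow> complex^'m" where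
  "harmonic_frame p g x =
     (\<chi> j. complex_of_real (1 / sqrt (real CARD('m))) *
           exp (2 * complex_of_real pi * \<i> * of_int (g j) * of_int x / of_nat p))"

end

theory Submission
  imports Defs "HOL-Number_Theory.Euler_Criterion"
begin

text \<open>
  The theorem is a computation in the Fourier transform of the indicator function of \<open>S\<close>, that is
  of \<open>char_sum p S t = (\<Sum>s\<in>S. exp (2 \<pi> \<i> s t / p))\<close>. The Hermitian product of \<open>f\<^sub>x\<close> and
  \<open>f\<^sub>y\<close> is \<open>char_sum p S (x - y) / m\<close>, and for fixed \<open>x\<close> the differences \<open>x - y\<close> run once through the
  nonzero residues. So the frame angles and their multiplicities are the values of
  \<open>cmod (char_sum p S t) / m\<close> at the nonzero \<open>t\<close>, each counted as often as it is taken. Tightness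
  is the orthogonality of the characters.

  Squaring the modulus turns \<open>S\<close> into its differences (\<open>power_spectrum\<close>): the square of
  \<open>cmod (char_sum p S t)\<close> is the Fourier transform of the function that counts in how many ways
  \<open>d\<close> is a difference of elements of \<open>S\<close>. For a Gaussian difference set this function is \<open>m\<close> at
  \<open>0\<close>, \<open>l\<close> on the squares and \<open>\<mu>\<close> on the nonsquares. Only the Fourier transforms of the
  squares and of the nonsquares are therefore needed, and they take just two values at nonzero
  arguments, the Gaussian period \<open>\<eta>\<close> and \<open>-1 - \<eta>\<close>, because multiplication by a square preserves
  the squares and multiplication by a nonsquare exchanges the two classes
  (\<open>bij_betw_mult_squares\<close>, \<open>char_sum_squares\<close>).

  If \<open>p\<close> is \<open>3\<close> modulo \<open>4\<close>, then \<open>-1\<close> is a nonsquare. Since \<open>d\<close> and \<open>-d\<close> are differences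
  equally often, \<open>l = \<mu>\<close>. Whenever \<open>l = \<mu>\<close>, the value \<open>\<eta>\<close> cancels: \<open>S\<close> is a difference set and
  all angles agree. The remaining case is that \<open>p\<close> is \<open>1\<close> modulo \<open>4\<close> and \<open>l \<noteq> \<mu>\<close>. Then \<open>-1\<close> is a
  square, so \<open>\<eta>\<close> is real, and Parseval's identity for the set of squares becomes
  \<open>(2 \<eta> + 1)\<^sup>2 = p\<close> (\<open>gauss_period_real\<close>). The sign of \<open>2 \<eta> + 1\<close>, the classical difficulty
  with Gauss sums, only decides which of the two angles belongs to the squares; since there are as
  many squares as nonsquares, it does not affect the result.
\<close>


section \<open>Additive characters modulo p\<close>

definition add_char :: "nat \<Rightarrow> int \<Rightarrow> complex" where
  "add_char p a = cis (2 * pi * (of_int a / of_nat p))"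

lemma add_char_add: "add_char p (a + b) = add_char p a * add_char p b"
  by (simp add: add_char_def cis_mult add_divide_distrib ring_distribs)

lemma add_char_0 [simp]: "add_char p 0 = 1"
  by (simp add: add_char_def)

lemma cnj_add_char [simp]: "cnj (add_char p a) = add_char p (- a)"
  by (simp add: add_char_def cis_cnj)

lemma norm_add_char [simp]: "cmod (add_char p a) = 1"
  by (simp add: add_char_def)

lemma add_char_mult: "add_char p (a * int n) = add_char p a ^ n"
  unfolding add_char_def Complex.DeMoivre by (rule arg_cong[where f = cis]) simp

lemma add_char_eq_1_iff:
  assumes "p > 0"
  shows "add_char p a = 1 \<longleftrightarrow> int p dvd a"
proof
  assume "add_char p a = 1"
  then have "exp (\<i> * complex_of_real (2 * pi * (of_int a / of_nat p))) = 1"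
    by (simp add: add_char_def cis_conv_exp)
  then obtain n :: int where "2 * pi * (of_int a / of_nat p) = of_int (2 * n) * pi"
    unfolding exp_eq_1 by auto
  then have "real_of_int a = of_int (n * int p)"
    using assms by (simp add: field_simps)
  then have "a = n * int p" by (simp only: of_int_eq_iff)
  then show "int p dvd a" by simp
next
  assume "int p dvd a"
  then obtain k where k: "a = int p * k" by (rule dvdE)
  show "add_char p a = 1"
    using assms unfolding add_char_def k by (simp add: cis_multiple_2pi)
qed

lemma add_char_cong:
  assumes "p > 0" "[a = b] (mod int p)"
  shows "add_char p a = add_char p b"
proof -
  have "add_char p a = add_char p b * add_char p (a - b)"
    using add_char_add[of p b "a - b"] by simp
  also have "add_char p (a - b) = 1"
    using assms by (simp add: add_char_eq_1_iff cong_iff_dvd_diff)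
  finally show ?thesis by simp
qed

text \<open>Orthogonality of characters; the sum is a geometric series in a \<open>p\<close>-th root of unity.\<close>

lemma sum_add_char:
  assumes "p > 0"
  shows "(\<Sum>x\<in>{0..int p - 1}. add_char p (a * x)) = (if int p dvd a then of_nat p else 0)"
proof -
  have "{0..int p - 1} = int ` {..<p}"
    by (metis atLeastLessThanPlusOne_atLeastAtMost_int diff_add_cancel
        image_int_atLeastLessThan lessThan_atLeast0 of_nat_0)
  then have "(\<Sum>x\<in>{0..int p - 1}. add_char p (a * x)) = (\<Sum>n<p. add_char p a ^ n)"
    by (simp add: sum.reindex add_char_mult)
  also have "\<dots> = (if int p dvd a then of_nat p else 0)"
  proof (cases "int p dvd a")
    case True
    then have "add_char p a = 1" using assms by (simp add: add_char_eq_1_iff)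
    then show ?thesis using True by simp
  next
    case False
    then have "add_char p a \<noteq> 1" using assms by (simp add: add_char_eq_1_iff)
    moreover have "add_char p a ^ p = 1"
      using add_char_eq_1_iff[OF assms, of "a * int p"] by (simp add: add_char_mult)
    ultimately show ?thesis using False by (simp add: geometric_sum)
  qed
  finally show ?thesis .
qed


section \<open>Differences and the power spectrum of a set of residues\<close>

lemma Zmod_simps:
  assumes "p > 1"
  shows "carrier (Zmod p) = {0..int p - 1}" "\<zero>\<^bsub>Zmod p\<^esub> = 0"
    "a \<ominus>\<^bsub>Zmod p\<^esub> b = (a - b) mod int p"
proof -
  interpret residues "int p" "Zmod p" by unfold_locales (use assms in auto)
  show "carrier (Zmod p) = {0..int p - 1}" "\<zero>\<^bsub>Zmod p\<^esub> = 0"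
    by (rule res_carrier_eq res_zero_eq)+
  show "a \<ominus>\<^bsub>Zmod p\<^esub> b = (a - b) mod int p"
    by (simp add: a_minus_def res_neg_eq res_add_eq mod_simps)
qed

lemma diff_count_alt:
  assumes "p > 1"
  shows "diff_count p S d = card {ab \<in> S \<times> S. (fst ab - snd ab) mod int p = d}"
  unfolding diff_count_def Zmod_simps(3)[OF assms]
  by (rule arg_cong[where f = card]) auto

text \<open>Exchanging \<open>a\<close> and \<open>b\<close> negates the difference.\<close>

lemma diff_count_uminus:
  assumes "p > 1" "d \<in> {0..int p - 1}"
  shows "diff_count p S ((- d) mod int p) = diff_count p S d"
  unfolding diff_count_alt[OF assms(1)]
proof (rule bij_betw_same_card[where f = prod.swap], rule bij_betwI')
  fix ab assume "ab \<in> {ab \<in> S \<times> S. (fst ab - snd ab) mod int p = (- d) mod int p}"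
  then have "[fst ab - snd ab = - d] (mod int p)" "ab \<in> S \<times> S" by (auto simp: cong_def)
  then have "[snd ab - fst ab = d] (mod int p)"
    using cong_minus_minus_iff[of "fst ab - snd ab" "- d" "int p"] by simp
  then show "prod.swap ab \<in> {ab \<in> S \<times> S. (fst ab - snd ab) mod int p = d}"
    using \<open>ab \<in> S \<times> S\<close> assms by (auto simp: cong_def)
next
  fix ab assume ab: "ab \<in> {ab \<in> S \<times> S. (fst ab - snd ab) mod int p = d}"
  then have "[fst ab - snd ab = d] (mod int p)" using assms by (auto simp: cong_def)
  then have "[snd ab - fst ab = - d] (mod int p)"
    using cong_minus_minus_iff[of "fst ab - snd ab" "d" "int p"] by simp
  then show "\<exists>x\<in>{ab \<in> S \<times> S. (fst ab - snd ab) mod int p = (- d) mod int p}. ab = prod.swap x"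
    using ab by (intro bexI[of _ "prod.swap ab"]) (auto simp: cong_def)
qed auto

lemma diff_count_0:
  assumes "p > 1" "S \<subseteq> {0..int p - 1}"
  shows "diff_count p S 0 = card S"
proof -
  have eq: "a = b" if "a \<in> S" "b \<in> S" "int p dvd a - b" for a b
  proof -
    have "[a = b] (mod int p)" using that(3) by (simp add: cong_iff_dvd_diff)
    moreover have "0 \<le> a" "a < int p" "0 \<le> b" "b < int p" using that assms(2) by auto
    ultimately show ?thesis by (simp add: cong_def)
  qed
  have "{ab \<in> S \<times> S. (fst ab - snd ab) mod int p = 0} = (\<lambda>a. (a, a)) ` S"
    by (auto simp: mod_eq_0_iff_dvd image_iff dest: eq)
  then show ?thesis
    unfolding diff_count_alt[OF assms(1)] by (simp add: card_image inj_on_def)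
qed

text \<open>The discrete Fourier transform, at frequency \<open>t\<close>, of the indicator function of \<open>S\<close>.\<close>

definition char_sum :: "nat \<Rightarrow> int set \<Rightarrow> int \<Rightarrow> complex" where
  "char_sum p S t = (\<Sum>s\<in>S. add_char p (s * t))"

lemma char_sum_cong:
  assumes "p > 0" "[t = u] (mod int p)"
  shows "char_sum p S t = char_sum p S u"
  unfolding char_sum_def
  by (intro sum.cong refl add_char_cong cong_scalar_left assms)

text \<open>
  The Wiener--Khinchin relation: expanding \<open>char_sum p S t * cnj (char_sum p S t)\<close> gives one
  character value for each pair \<open>(a, b)\<close>, which depends only on \<open>a - b\<close> modulo \<open>p\<close>, and the pairs
  are then grouped by this difference.
\<close>

lemma power_spectrum:
  assumes "p > 1" "S \<subseteq> {0..int p - 1}"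
  shows "complex_of_real ((cmod (char_sum p S t))\<^sup>2) =
           (\<Sum>d\<in>{0..int p - 1}. of_nat (diff_count p S d) * add_char p (d * t))"
proof -
  have fin: "finite S" using assms(2) finite_subset by blast
  have "complex_of_real ((cmod (char_sum p S t))\<^sup>2) =
      (\<Sum>a\<in>S. \<Sum>b\<in>S. add_char p (a * t) * add_char p (- (b * t)))"
    by (simp add: complex_norm_square char_sum_def sum_product del: of_real_power)
  also have "\<dots> = (\<Sum>ab\<in>S \<times> S. add_char p ((fst ab - snd ab) mod int p * t))"
    unfolding sum.cartesian_product
  proof (rule sum.cong[OF refl], clarsimp)
    fix a b
    have "add_char p (a * t) * add_char p (- (b * t)) = add_char p ((a - b) * t)"
      by (simp add: add_char_add[symmetric] algebra_simps)
    also have "\<dots> = add_char p ((a - b) mod int p * t)"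
      using assms by (intro add_char_cong cong_scalar_right) (auto simp: cong_def)
    finally show "add_char p (a * t) * add_char p (- (b * t)) = add_char p ((a - b) mod int p * t)" .
  qed
  also have "\<dots> = (\<Sum>d\<in>{0..int p - 1}. \<Sum>ab\<in>{ab \<in> S \<times> S. (fst ab - snd ab) mod int p = d}.
      add_char p ((fst ab - snd ab) mod int p * t))"
    using assms fin by (intro sum.group[symmetric]) auto
  also have "\<dots> = (\<Sum>d\<in>{0..int p - 1}. of_nat (diff_count p S d) * add_char p (d * t))"
    unfolding diff_count_alt[OF assms(1)] by (intro sum.cong refl) simp
  finally show ?thesis .
qed

text \<open>Summed over all \<open>t\<close>, the power spectrum keeps only the pairs with difference zero.\<close>

lemma parseval:
  assumes "p > 1" "S \<subseteq> {0..int p - 1}"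
  shows "(\<Sum>t\<in>{0..int p - 1}. (cmod (char_sum p S t))\<^sup>2) = real p * real (card S)"
proof -
  let ?C = "{0..int p - 1}"
  have "complex_of_real (\<Sum>t\<in>?C. (cmod (char_sum p S t))\<^sup>2) =
      (\<Sum>t\<in>?C. \<Sum>d\<in>?C. of_nat (diff_count p S d) * add_char p (d * t))"
    using power_spectrum[OF assms] by (simp del: of_real_power)
  also have "\<dots> = (\<Sum>d\<in>?C. of_nat (diff_count p S d) * (\<Sum>t\<in>?C. add_char p (d * t)))"
    by (subst sum.swap) (simp add: sum_distrib_left)
  also have "\<dots> = (\<Sum>d\<in>?C. if d = 0 then of_nat (diff_count p S d) * of_nat p else 0)"
    using assms(1) by (intro sum.cong refl) (auto simp: sum_add_char dest: zdvd_imp_le)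
  also have "\<dots> = complex_of_real (real p * real (card S))"
    using assms by (simp add: diff_count_0)
  finally show ?thesis by (simp only: of_real_eq_iff)
qed


lemma char_sum_0:
  "char_sum p S 0 = of_nat (card S)"
  by (simp add: char_sum_def)


section \<open>Squares and nonsquares modulo an odd prime\<close>

lemma nonzero_squares_image:
  assumes "prime p"
  shows "nonzero_squares p = (\<lambda>z. z\<^sup>2 mod int p) ` {1..int p - 1}"
proof -
  interpret residues_prime p "Zmod p" by unfold_locales (use assms in auto)
  have "Units (Zmod p) = {1..int p - 1}"
    using m_gt_one by (simp add: res_prime_units_eq of_nat_diff)
  moreover have "z [^]\<^bsub>Zmod p\<^esub> (2::nat) = z\<^sup>2 mod int p" if "z \<in> {1..int p - 1}" for z
    using pow_cong[of z 2] that by simp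
  ultimately show ?thesis
    unfolding nonzero_squares_def by (force simp: image_iff)
qed

lemma nonzero_squares_eq:
  assumes "prime p"
  shows "nonzero_squares p = {a \<in> {1..int p - 1}. QuadRes (int p) a}"
proof (intro equalityI subsetI)
  have prime: "prime (int p)" using assms by simp
  note p = prime_gt_0_int[OF prime]
  fix a assume "a \<in> nonzero_squares p"
  then obtain z where z: "z \<in> {1..int p - 1}" and a: "a = z\<^sup>2 mod int p"
    unfolding nonzero_squares_image[OF assms] by auto
  have "\<not> int p dvd z" using z by (auto dest: zdvd_imp_le)
  then have "a \<noteq> 0" using prime a by (auto simp: mod_eq_0_iff_dvd prime_dvd_power_iff)
  moreover have "0 \<le> a" "a < int p" using a p by auto
  moreover have "QuadRes (int p) a"
    unfolding QuadRes_def by (rule exI[of _ z]) (simp add: a cong_def)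
  ultimately show "a \<in> {a \<in> {1..int p - 1}. QuadRes (int p) a}" by auto
next
  fix a assume "a \<in> {a \<in> {1..int p - 1}. QuadRes (int p) a}"
  then obtain y where a: "a \<in> {1..int p - 1}" and y: "[y\<^sup>2 = a] (mod int p)"
    by (auto simp: QuadRes_def)
  have za: "(y mod int p)\<^sup>2 mod int p = a"
    using a y by (simp add: power_mod cong_def)
  then have "y mod int p \<noteq> 0" using a by auto
  moreover have "0 \<le> y mod int p" "y mod int p < int p" using a by simp_all
  ultimately have "y mod int p \<in> {1..int p - 1}" by auto
  then show "a \<in> nonzero_squares p"
    unfolding nonzero_squares_image[OF assms] using za by (intro image_eqI[of _ _ "y mod int p"]) auto
qed

lemma QuadRes_cong: "[a = b] (mod p) \<Longrightarrow> QuadRes p a \<longleftrightarrow> QuadRes p b"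
  unfolding QuadRes_def using cong_trans cong_sym by blast

text \<open>
  A square factor can be cancelled because its inverse is a square too: if \<open>c\<close> inverts \<open>a = y\<^sup>2\<close>,
  then \<open>b\<close> is \<open>(y c)\<^sup>2\<close> times \<open>a b\<close>.
\<close>

lemma QuadRes_mult_iff:
  fixes p :: int
  assumes "coprime a p" "QuadRes p a"
  shows "QuadRes p (a * b) \<longleftrightarrow> QuadRes p b"
proof
  from assms(2) obtain y where y: "[y\<^sup>2 = a] (mod p)" by (auto simp: QuadRes_def)
  show "QuadRes p (a * b)" if "QuadRes p b"
  proof -
    from that obtain z where "[z\<^sup>2 = b] (mod p)" by (auto simp: QuadRes_def)
    with y have "[(y * z)\<^sup>2 = a * b] (mod p)"
      unfolding power_mult_distrib by (rule cong_mult)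
    then show ?thesis by (auto simp: QuadRes_def)
  qed
  show "QuadRes p b" if "QuadRes p (a * b)"
  proof -
    from that obtain z where z: "[z\<^sup>2 = a * b] (mod p)" by (auto simp: QuadRes_def)
    obtain c where c: "[a * c = 1] (mod p)"
      using assms(1) cong_solve_coprime_int by blast
    have "[(y * c * z)\<^sup>2 = (a * c\<^sup>2) * (a * b)] (mod p)"
      unfolding power_mult_distrib by (intro cong_mult y z cong_refl)
    also have "(a * c\<^sup>2) * (a * b) = (a * c) * (a * c) * b" by (simp add: power2_eq_square)
    also have "[(a * c) * (a * c) * b = 1 * 1 * b] (mod p)"
      by (intro cong_mult c cong_refl)
    finally show ?thesis by (auto simp: QuadRes_def)
  qed
qed

text \<open>The first supplement to quadratic reciprocity, read off from Euler's criterion.\<close>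

lemma QuadRes_minus_1_iff:
  assumes "prime p" "odd p"
  shows "QuadRes (int p) (-1) \<longleftrightarrow> [p = 1] (mod 4)"
proof -
  have p2: "p > 2" using assms by (metis even_numeral prime_ge_2_nat le_neq_implies_less)
  then have n1: "\<not> [1 = (- 1 :: int)] (mod int p)" "\<not> [(- 1) = (1 :: int)] (mod int p)"
    "\<not> [- 1 = (0 :: int)] (mod int p)"
    by (auto simp: cong_iff_dvd_diff dest: zdvd_imp_le)
  have e: "[Legendre (-1) (int p) = (-1) ^ ((p - 1) div 2)] (mod int p)"
    using euler_criterion[OF assms(1) p2] .
  have "QuadRes (int p) (-1) \<longleftrightarrow> even ((p - 1) div 2)"
    using e n1 by (cases "even ((p - 1) div 2)") (auto simp: Legendre_def split: if_splits)
  also have "\<dots> \<longleftrightarrow> p mod 4 = 1"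
    using assms(2) p2 by presburger
  finally show ?thesis by (simp add: cong_def)
qed

text \<open>
  Squaring identifies \<open>z\<close> with \<open>- z\<close> and nothing else, so it is a bijection from the lower half
  of the nonzero residues to the squares.
\<close>

lemma card_nonzero_squares:
  assumes "prime p" "odd p"
  shows "card (nonzero_squares p) = (p - 1) div 2"
proof -
  let ?h = "(int p - 1) div 2"
  have prime: "prime (int p)" using assms by simp
  have p: "int p = 2 * ?h + 1" using assms(2) by (simp add: odd_two_times_div_two_succ[symmetric])
  have nd: "\<not> int p dvd z" if "z \<in> {1..int p - 1}" for z
    using that by (auto dest: zdvd_imp_le)
  have "bij_betw (\<lambda>z. z\<^sup>2 mod int p) {1..?h} (nonzero_squares p)"
  proof (rule bij_betw_imageI)
    show "inj_on (\<lambda>z. z\<^sup>2 mod int p) {1..?h}"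
    proof (rule inj_onI)
      fix x y assume xy: "x \<in> {1..?h}" "y \<in> {1..?h}" and "x\<^sup>2 mod int p = y\<^sup>2 mod int p"
      then have "int p dvd (x + y) * (x - y)"
        by (simp add: mod_eq_dvd_iff power2_eq_square algebra_simps)
      moreover have "\<not> int p dvd x + y" using nd[of "x + y"] xy p by auto
      ultimately have "int p dvd x - y" using prime prime_dvd_mult_iff by blast
      then have "x mod int p = y mod int p" by (simp add: mod_eq_dvd_iff)
      moreover have "x < int p" "y < int p" using xy p by auto
      ultimately show "x = y" using xy by simp
    qed
    have "z\<^sup>2 mod int p \<in> (\<lambda>z. z\<^sup>2 mod int p) ` {1..?h}" if z: "z \<in> {1..int p - 1}" for z
    proof (cases "z \<le> ?h")
      case True
      then show ?thesis using z by (intro image_eqI[of _ _ z]) auto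
    next
      case False
      have "[int p - z = - z] (mod int p)" by (simp add: cong_iff_dvd_diff)
      from cong_pow[OF this, of 2] have "z\<^sup>2 mod int p = (int p - z)\<^sup>2 mod int p"
        by (simp add: cong_def)
      then show ?thesis using False z p by (intro image_eqI[of _ _ "int p - z"]) auto
    qed
    then show "(\<lambda>z. z\<^sup>2 mod int p) ` {1..?h} = nonzero_squares p"
      unfolding nonzero_squares_image[OF assms(1)] using p by (intro equalityI image_mono image_subsetI) auto
  qed
  from bij_betw_same_card[OF this] show ?thesis
    using assms(2) by (simp add: nat_div_distrib nat_diff_distrib)
qed

definition nonsquares :: "nat \<Rightarrow> int set" where
  "nonsquares p = {a \<in> {1..int p - 1}. \<not> QuadRes (int p) a}"

lemma carrier_partition:
  assumes "prime p"
  shows "nonzero_squares p \<union> nonsquares p = {1..int p - 1}"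
    and "nonzero_squares p \<inter> nonsquares p = {}"
    and "carrier (Zmod p) - (nonzero_squares p \<union> {\<zero>\<^bsub>Zmod p\<^esub>}) = nonsquares p"
    and "{0..int p - 1} = insert 0 {1..int p - 1}"
    and "finite (nonzero_squares p)" "finite (nonsquares p)"
proof -
  show "finite (nonzero_squares p)" "finite (nonsquares p)"
    by (rule finite_subset[of _ "{1..int p - 1}"];
        auto simp: nonzero_squares_eq[OF assms] nonsquares_def)+
  have p: "p > 1" using assms prime_gt_1_nat by blast
  show "carrier (Zmod p) - (nonzero_squares p \<union> {\<zero>\<^bsub>Zmod p\<^esub>}) = nonsquares p"
    unfolding nonzero_squares_eq[OF assms] nonsquares_def Zmod_simps[OF p] by auto
qed (use prime_gt_1_nat[OF assms] in \<open>auto simp: nonzero_squares_eq[OF assms] nonsquares_def\<close>)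

lemma card_nonsquares:
  assumes "prime p" "odd p"
  shows "card (nonsquares p) = (p - 1) div 2"
proof -
  have "card (nonzero_squares p) + card (nonsquares p) = card {1..int p - 1}"
    using carrier_partition[OF assms(1)] by (metis card_Un_disjoint)
  then have "(p - 1) div 2 + card (nonsquares p) = p - 1"
    by (simp add: card_nonzero_squares assms nat_diff_distrib)
  then show ?thesis using assms(2) by presburger
qed

text \<open>
  In both parts multiplication by \<open>t\<close> is injective and maps the squares into the asserted image by
  multiplicativity of the residue symbol. Surjectivity is a count, since there are as many
  nonsquares as squares.
\<close>

lemma bij_betw_mult_squares:
  assumes "prime p" "odd p"
  shows "t \<in> nonzero_squares p \<Longrightarrow>
           bij_betw (\<lambda>r. (r * t) mod int p) (nonzero_squares p) (nonzero_squares p)"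
    and "t \<in> nonsquares p \<Longrightarrow>
           bij_betw (\<lambda>r. (r * t) mod int p) (nonzero_squares p) (nonsquares p)"
proof -
  let ?f = "\<lambda>t r. (r * t) mod int p"
  have prime: "prime (int p)" using assms by simp
  have unit: "\<not> int p dvd z" "coprime z (int p)" if "z \<in> {1..int p - 1}" for z
  proof -
    show "\<not> int p dvd z" using that by (auto dest: zdvd_imp_le)
    then show "coprime z (int p)" using prime prime_imp_coprime coprime_commute by blast
  qed
  have inj: "inj_on (?f t) (nonzero_squares p)" if t: "t \<in> {1..int p - 1}" for t
  proof (rule inj_onI)
    fix x y assume xy: "x \<in> nonzero_squares p" "y \<in> nonzero_squares p" "?f t x = ?f t y"
    then have "[x = y] (mod int p)"
      using cong_mult_rcancel[of t "int p" x y] unit(2)[OF t] by (simp add: cong_def)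
    then show "x = y"
      using xy by (simp add: nonzero_squares_eq[OF assms(1)] cong_def)
  qed
  have im: "?f t r \<in> {1..int p - 1}" "QuadRes (int p) (?f t r) \<longleftrightarrow> QuadRes (int p) t"
    if t: "t \<in> {1..int p - 1}" and r: "r \<in> nonzero_squares p" for t r
  proof -
    have r': "r \<in> {1..int p - 1}" "QuadRes (int p) r"
      using r by (auto simp: nonzero_squares_eq[OF assms(1)])
    then have "?f t r \<noteq> 0"
      using unit(1)[OF t] unit(1)[OF r'(1)] prime by (simp add: mod_eq_0_iff_dvd prime_dvd_mult_iff)
    moreover have "0 \<le> ?f t r" "?f t r < int p" using prime_gt_0_int[OF prime] by auto
    ultimately show "?f t r \<in> {1..int p - 1}" by auto
    have "QuadRes (int p) (?f t r) \<longleftrightarrow> QuadRes (int p) (r * t)"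
      by (rule QuadRes_cong) (simp add: cong_def)
    then show "QuadRes (int p) (?f t r) \<longleftrightarrow> QuadRes (int p) t"
      using QuadRes_mult_iff unit(2) r' by simp
  qed
  show "bij_betw (?f t) (nonzero_squares p) (nonzero_squares p)" if "t \<in> nonzero_squares p"
  proof -
    from that have t: "t \<in> {1..int p - 1}" "QuadRes (int p) t"
      by (auto simp: nonzero_squares_eq[OF assms(1)])
    have "?f t ` nonzero_squares p \<subseteq> nonzero_squares p"
      using im[OF t(1)] t(2) by (auto simp: nonzero_squares_eq[OF assms(1)])
    then show ?thesis
      using inj[OF t(1)] carrier_partition(5)[OF assms(1)]
      by (simp add: bij_betw_def endo_inj_surj)
  qed
  show "bij_betw (?f t) (nonzero_squares p) (nonsquares p)" if "t \<in> nonsquares p"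
  proof -
    from that have t: "t \<in> {1..int p - 1}" "\<not> QuadRes (int p) t"
      by (auto simp: nonsquares_def)
    have "?f t ` nonzero_squares p \<subseteq> nonsquares p"
      using im[OF t(1)] t(2) by (auto simp: nonsquares_def)
    moreover have "card (?f t ` nonzero_squares p) = card (nonsquares p)"
      using inj[OF t(1)] assms by (simp add: card_image card_nonzero_squares card_nonsquares)
    ultimately have "?f t ` nonzero_squares p = nonsquares p"
      using carrier_partition(6)[OF assms(1)] by (intro card_subset_eq)
    then show ?thesis using inj[OF t(1)] by (simp add: bij_betw_def)
  qed
qed



section \<open>The quadratic Gaussian period\<close>

text \<open>
  The characters of \<open>0\<close>, of the squares and of the nonsquares sum to zero by orthogonality.
\<close>

lemma char_sum_nonsquares:
  assumes "prime p" "\<not> int p dvd t"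
  shows "char_sum p (nonsquares p) t = - 1 - char_sum p (nonzero_squares p) t"
proof -
  have p: "p > 0" using assms(1) prime_gt_0_nat by blast
  have "(\<Sum>x\<in>{0..int p - 1}. add_char p (x * t)) = 0"
    using sum_add_char[OF p, of t] assms(2) by (simp add: mult.commute)
  then have "1 + (\<Sum>x\<in>nonzero_squares p \<union> nonsquares p. add_char p (x * t)) = 0"
    unfolding carrier_partition(4)[OF assms(1)] carrier_partition(1)[OF assms(1)] by simp
  then have "1 + (char_sum p (nonzero_squares p) t + char_sum p (nonsquares p) t) = 0"
    unfolding char_sum_def using carrier_partition(2,5,6)[OF assms(1)]
    by (simp add: sum.union_disjoint)
  then show ?thesis by (simp add: algebra_simps eq_neg_iff_add_eq_0)
qed

text \<open>
  The quadratic Gauss sum is \<open>2 * gauss_period p + 1\<close>.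
\<close>

definition gauss_period :: "nat \<Rightarrow> complex" where
  "gauss_period p = char_sum p (nonzero_squares p) 1"

text \<open>
  The substitution \<open>r \<mapsto> r t\<close> turns the sum over the squares at \<open>t\<close> into a sum at \<open>1\<close> over the squares
  or over the nonsquares.
\<close>

lemma char_sum_squares:
  assumes "prime p" "odd p"
  shows "t \<in> nonzero_squares p \<Longrightarrow> char_sum p (nonzero_squares p) t = gauss_period p"
    and "t \<in> nonsquares p \<Longrightarrow> char_sum p (nonzero_squares p) t = - 1 - gauss_period p"
proof -
  have p: "p > 0" using assms(1) prime_gt_0_nat by blast
  have reindex: "char_sum p (nonzero_squares p) t = char_sum p B 1"
    if "bij_betw (\<lambda>r. (r * t) mod int p) (nonzero_squares p) B" for B
  proof -
    have "char_sum p B 1 = (\<Sum>r\<in>nonzero_squares p. add_char p ((r * t) mod int p))"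
      unfolding char_sum_def by (simp add: sum.reindex_bij_betw[OF that, symmetric])
    also have "\<dots> = char_sum p (nonzero_squares p) t"
      unfolding char_sum_def using p
      by (intro sum.cong refl add_char_cong) (auto simp: cong_def)
    finally show ?thesis by simp
  qed
  show "t \<in> nonzero_squares p \<Longrightarrow> char_sum p (nonzero_squares p) t = gauss_period p"
    using bij_betw_mult_squares(1)[OF assms] reindex by (simp add: gauss_period_def)
  show "t \<in> nonsquares p \<Longrightarrow> char_sum p (nonzero_squares p) t = - 1 - gauss_period p"
    using bij_betw_mult_squares(2)[OF assms] reindex[of "nonsquares p"]
      char_sum_nonsquares[OF assms(1), of 1] prime_gt_1_nat[OF assms(1)]
    by (simp add: gauss_period_def)
qed

text \<open>
  As \<open>-1\<close> is a square, conjugation permutes the terms of the period, which is therefore real. The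
  Fourier transform of the squares is \<open>(p - 1) / 2\<close> at \<open>0\<close>, equals \<open>\<eta>\<close> on the squares and
  \<open>-1 - \<eta>\<close> on the nonsquares, so Parseval's identity is a quadratic equation for \<open>\<eta>\<close>.
\<close>

lemma gauss_period_real:
  assumes "prime p" "[p = 1] (mod 4)"
  obtains \<eta> :: real where "gauss_period p = complex_of_real \<eta>"
    "2 * \<eta> + 1 = sqrt (real p) \<or> 2 * \<eta> + 1 = - sqrt (real p)"
proof -
  have "p mod 4 = 1" using assms(2) by (simp add: cong_def)
  then have odd: "odd p" by presburger
  have p: "p > 1" using assms(1) prime_gt_1_nat by blast
  let ?R = "nonzero_squares p" and ?N = "nonsquares p"
  have "QuadRes (int p) (int p - 1)"
    using QuadRes_minus_1_iff[OF assms(1) odd] assms(2)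
      QuadRes_cong[of "int p - 1" "-1" "int p"] by (simp add: cong_iff_dvd_diff)
  then have "int p - 1 \<in> ?R" using p by (simp add: nonzero_squares_eq[OF assms(1)])
  then have "gauss_period p = char_sum p ?R (int p - 1)"
    by (simp add: char_sum_squares[OF assms(1) odd])
  also have "\<dots> = char_sum p ?R (- 1)"
    using p by (intro char_sum_cong) (auto simp: cong_iff_dvd_diff)
  also have "\<dots> = cnj (gauss_period p)"
    by (simp add: gauss_period_def char_sum_def)
  finally have "gauss_period p \<in> \<real>" by (simp add: Reals_cnj_iff)
  then obtain \<eta> where \<eta>: "gauss_period p = complex_of_real \<eta>" by (auto elim: Reals_cases)
  have h: "real ((p - Suc 0) div 2) = (real p - 1) / 2"
    using odd p by (auto elim!: oddE)
  have R: "?R \<subseteq> {0..int p - 1}" by (auto simp: nonzero_squares_eq[OF assms(1)])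
  have R1: "(cmod (char_sum p ?R t))\<^sup>2 = \<eta>\<^sup>2" if "t \<in> ?R" for t
    using that by (simp add: char_sum_squares[OF assms(1) odd] \<eta>)
  have N1: "(cmod (char_sum p ?R t))\<^sup>2 = (1 + \<eta>)\<^sup>2" if "t \<in> ?N" for t
  proof -
    have "char_sum p ?R t = complex_of_real (- 1 - \<eta>)"
      using that by (simp add: char_sum_squares[OF assms(1) odd] \<eta>)
    then show ?thesis by (simp only: norm_of_real) (simp add: power2_eq_square algebra_simps)
  qed
  have "real p * ((real p - 1) / 2) = (\<Sum>t\<in>{0..int p - 1}. (cmod (char_sum p ?R t))\<^sup>2)"
    unfolding parseval[OF p R] by (simp add: card_nonzero_squares[OF assms(1) odd] h)
  also have "\<dots> = ((real p - 1) / 2)\<^sup>2 + (\<Sum>t\<in>?R \<union> ?N. (cmod (char_sum p ?R t))\<^sup>2)"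
    unfolding carrier_partition(4)[OF assms(1)] carrier_partition(1)[OF assms(1)]
    by (simp add: char_sum_0 card_nonzero_squares[OF assms(1) odd] h)
  also have "\<dots> = ((real p - 1) / 2)\<^sup>2 + (real p - 1) / 2 * (\<eta>\<^sup>2 + (1 + \<eta>)\<^sup>2)"
    using carrier_partition(2,5,6)[OF assms(1)] R1 N1
    by (simp add: sum.union_disjoint card_nonzero_squares[OF assms(1) odd]
        card_nonsquares[OF assms(1) odd] h ring_distribs)
  finally have "(real p - 1) / 2 * (real p - (real p - 1) / 2 - (\<eta>\<^sup>2 + (1 + \<eta>)\<^sup>2)) = 0"
    unfolding right_diff_distrib power2_eq_square[of "(real p - 1) / 2"]
    by (simp only: mult.commute[of _ "real p"])
  then have "real p - (real p - 1) / 2 - (\<eta>\<^sup>2 + (1 + \<eta>)\<^sup>2) = 0" using p by simp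
  then have "(2 * \<eta> + 1)\<^sup>2 = (sqrt (real p))\<^sup>2"
    by (simp add: power2_eq_square field_simps)
  then have "2 * \<eta> + 1 = sqrt (real p) \<or> 2 * \<eta> + 1 = - sqrt (real p)"
    by (simp only: power2_eq_iff)
  with \<eta> show thesis by (rule that)
qed


section \<open>Gaussian difference sets\<close>

text \<open>
  The difference counts \<open>m\<close>, \<open>l\<close> and \<open>\<mu>\<close> at zero, the squares and the nonsquares weight the
  corresponding three character sums in the power spectrum.
\<close>

lemma gaussian_difference_set_spectrum:
  assumes "prime p" "odd p" "gaussian_difference_set p m l \<mu> S"
  shows "t \<in> nonzero_squares p \<Longrightarrow> complex_of_real ((cmod (char_sum p S t))\<^sup>2) =
           of_nat m + of_nat l * gauss_period p + of_nat \<mu> * (- 1 - gauss_period p)"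
    and "t \<in> nonsquares p \<Longrightarrow> complex_of_real ((cmod (char_sum p S t))\<^sup>2) =
           of_nat m + of_nat l * (- 1 - gauss_period p) + of_nat \<mu> * gauss_period p"
proof -
  let ?R = "nonzero_squares p" and ?N = "nonsquares p"
  have p: "p > 1" using assms(1) prime_gt_1_nat by blast
  have S: "S \<subseteq> {0..int p - 1}" "card S = m"
    using assms(3) unfolding gaussian_difference_set_def Zmod_simps(1)[OF p] by auto
  have R: "\<And>d. d \<in> ?R \<Longrightarrow> diff_count p S d = l"
    and N: "\<And>d. d \<in> ?N \<Longrightarrow> diff_count p S d = \<mu>"
    using assms(3) unfolding gaussian_difference_set_def carrier_partition(3)[OF assms(1)] by auto
  have spec: "complex_of_real ((cmod (char_sum p S t))\<^sup>2) =
      of_nat m + of_nat l * char_sum p ?R t + of_nat \<mu> * char_sum p ?N t" for t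
  proof -
    have "complex_of_real ((cmod (char_sum p S t))\<^sup>2) =
        of_nat m + (\<Sum>d\<in>?R \<union> ?N. of_nat (diff_count p S d) * add_char p (d * t))"
      unfolding power_spectrum[OF p S(1)] carrier_partition(4)[OF assms(1)]
        carrier_partition(1)[OF assms(1)]
      by (simp add: diff_count_0[OF p S(1)] S(2))
    also have "(\<Sum>d\<in>?R \<union> ?N. of_nat (diff_count p S d) * add_char p (d * t)) =
        of_nat l * char_sum p ?R t + of_nat \<mu> * char_sum p ?N t"
      using carrier_partition(2,5,6)[OF assms(1)] R N
      by (simp add: sum.union_disjoint char_sum_def sum_distrib_left)
    finally show ?thesis by (simp add: add.assoc)
  qed
  have nd: "\<not> int p dvd t" if "t \<in> ?R \<union> ?N" for t
    using that unfolding carrier_partition(1)[OF assms(1)] by (auto dest: zdvd_imp_le)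
  show "t \<in> ?R \<Longrightarrow> complex_of_real ((cmod (char_sum p S t))\<^sup>2) =
           of_nat m + of_nat l * gauss_period p + of_nat \<mu> * (- 1 - gauss_period p)"
    unfolding spec using nd by (simp add: char_sum_nonsquares assms char_sum_squares)
  show "t \<in> ?N \<Longrightarrow> complex_of_real ((cmod (char_sum p S t))\<^sup>2) =
           of_nat m + of_nat l * (- 1 - gauss_period p) + of_nat \<mu> * gauss_period p"
    unfolding spec using nd by (simp add: char_sum_nonsquares assms char_sum_squares)
qed

text \<open>Here \<open>1\<close> is a square and \<open>-1\<close> is not, but both occur equally often as differences.\<close>

lemma gaussian_difference_set_3_mod_4:
  assumes "prime p" "odd p" "\<not> [p = 1] (mod 4)" "gaussian_difference_set p m l \<mu> S"
  shows "l = \<mu>"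
proof -
  have p: "p > 1" using assms(1) prime_gt_1_nat by blast
  have "1 \<in> nonzero_squares p"
    using p by (auto simp: nonzero_squares_eq[OF assms(1)] QuadRes_def intro: exI[of _ 1])
  moreover have "int p - 1 \<in> nonsquares p"
    using p QuadRes_minus_1_iff[OF assms(1,2)] assms(3)
      QuadRes_cong[of "int p - 1" "-1" "int p"]
    by (simp add: nonsquares_def cong_iff_dvd_diff)
  moreover have "diff_count p S (int p - 1) = diff_count p S 1"
    using diff_count_uminus[OF p, of 1 S] p by (simp add: zmod_zminus1_eq_if)
  ultimately show ?thesis
    using assms(4) unfolding gaussian_difference_set_def carrier_partition(3)[OF assms(1)] by metis
qed

lemma gaussian_difference_set_eq_params:
  assumes "prime p" "gaussian_difference_set p m l l S"
  shows "difference_set p m l S"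
proof -
  have p: "p > 1" using assms(1) prime_gt_1_nat by blast
  show ?thesis
    using assms(2) carrier_partition(1,3,4)[OF assms(1)]
    unfolding gaussian_difference_set_def difference_set_def Zmod_simps[OF p] by auto
qed



section \<open>Harmonic frames\<close>

lemma harmonic_frame_nth:
  "harmonic_frame p (g :: 'm::finite \<Rightarrow> int) x $ j =
     complex_of_real (1 / sqrt (real CARD('m))) * add_char p (g j * x)"
  by (simp add: harmonic_frame_def add_char_def cis_conv_exp mult_ac)

lemma herm_prod_harmonic_frame:
  fixes g :: "'m::finite \<Rightarrow> int"
  assumes "bij_betw g UNIV S"
  shows "herm_prod (harmonic_frame p g x) (harmonic_frame p g y) =
           char_sum p S (x - y) / of_nat CARD('m)"
proof -
  let ?c = "complex_of_real (1 / sqrt (real CARD('m)))"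
  have c: "?c * ?c = 1 / of_nat CARD('m)"
    unfolding of_real_mult[symmetric] by (simp add: real_sqrt_mult_self)
  have "herm_prod (harmonic_frame p g x) (harmonic_frame p g y) =
      (\<Sum>j\<in>UNIV. ?c * ?c * (add_char p (g j * x) * add_char p (- (g j * y))))"
    unfolding herm_prod_def harmonic_frame_nth by (simp add: mult_ac)
  also have "\<dots> = (\<Sum>j\<in>UNIV. add_char p (g j * (x - y))) / of_nat CARD('m)"
    unfolding c add_char_add[symmetric] by (simp add: sum_divide_distrib algebra_simps)
  also have "(\<Sum>j\<in>UNIV. add_char p (g j * (x - y))) = char_sum p S (x - y)"
    unfolding char_sum_def by (rule sum.reindex_bij_betw[OF assms])
  finally show ?thesis .
qed

lemma unit_norm_harmonic_frame: "unit_norm X (harmonic_frame p (g :: 'm::finite \<Rightarrow> int))"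
  unfolding unit_norm_def norm_vec_def L2_set_def harmonic_frame_nth
  by (simp add: norm_mult norm_divide power_divide)

text \<open>
  The \<open>(i, j)\<close> entry of the frame operator sums the character of \<open>(g i - g j) x\<close> over all \<open>x\<close>; by
  orthogonality it vanishes unless \<open>g i\<close> and \<open>g j\<close> are congruent, that is, unless \<open>i = j\<close>.
\<close>

lemma tight_frame_harmonic_frame:
  fixes g :: "'m::finite \<Rightarrow> int"
  assumes "p > 1" "inj g" "range g \<subseteq> {0..int p - 1}"
  shows "tight_frame {0..int p - 1} (harmonic_frame p g)"
proof -
  let ?c = "complex_of_real (1 / sqrt (real CARD('m)))"
  let ?a = "real p / real CARD('m)"
  have c: "?c * ?c = 1 / of_nat CARD('m)"
    unfolding of_real_mult[symmetric] by (simp add: real_sqrt_mult_self)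
  have entry: "(\<Sum>x\<in>{0..int p - 1}. outer_prod (harmonic_frame p g x)) $ i $ j =
      mat (complex_of_real ?a) $ i $ j" for i j
  proof -
    have "(\<Sum>x\<in>{0..int p - 1}. outer_prod (harmonic_frame p g x)) $ i $ j =
        (\<Sum>x\<in>{0..int p - 1}. ?c * ?c * (add_char p (g i * x) * add_char p (- (g j * x))))"
      by (simp add: outer_prod_def harmonic_frame_nth mult_ac)
    also have "\<dots> = (\<Sum>x\<in>{0..int p - 1}. add_char p ((g i - g j) * x)) / of_nat CARD('m)"
      unfolding c add_char_add[symmetric] by (simp add: sum_divide_distrib algebra_simps)
    also have "\<dots> = mat (complex_of_real ?a) $ i $ j"
    proof -
      have "int p dvd g i - g j \<longleftrightarrow> i = j"
      proof
        assume "int p dvd g i - g j"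
        moreover have "g i \<in> {0..int p - 1}" "g j \<in> {0..int p - 1}" using assms(3) by blast+
        ultimately have "g i = g j" by (simp add: mod_eq_dvd_iff[symmetric])
        then show "i = j" using assms(2) by (simp add: inj_eq)
      qed simp
      then show ?thesis using assms(1) by (simp add: sum_add_char mat_def)
    qed
    finally show ?thesis .
  qed
  show ?thesis
    unfolding tight_frame_def
    by (rule exI[of _ ?a]) (use assms(1) entry in \<open>auto simp: vec_eq_iff\<close>)
qed

lemma cmod_herm_prod_harmonic_frame:
  fixes g :: "'m::finite \<Rightarrow> int"
  assumes "p > 0" "bij_betw g UNIV S"
  shows "cmod (herm_prod (harmonic_frame p g x) (harmonic_frame p g y)) =
           cmod (char_sum p S ((x - y) mod int p)) / real CARD('m)"
proof -
  have "char_sum p S (x - y) = char_sum p S ((x - y) mod int p)"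
    by (rule char_sum_cong[OF assms(1)]) (simp add: cong_def)
  then show ?thesis by (simp add: herm_prod_harmonic_frame[OF assms(2)] norm_divide)
qed

text \<open>
  This transfers counts of indices \<open>y \<noteq> x\<close> to counts of nonzero residues, independently of \<open>x\<close>.
\<close>

lemma bij_betw_residue_diff:
  assumes "p > 0" "x \<in> {0..int p - 1}"
  shows "bij_betw (\<lambda>y. (x - y) mod int p) ({0..int p - 1} - {x}) {1..int p - 1}"
proof (rule bij_betw_byWitness[where f' = "\<lambda>t. (x - t) mod int p"])
  have inv: "(x - (x - y) mod int p) mod int p = y mod int p" for y
    by (simp add: mod_diff_right_eq)
  have nz: "(x - y) mod int p \<noteq> 0" if "y \<in> {0..int p - 1}" "y \<noteq> x" for y
  proof
    assume "(x - y) mod int p = 0"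
    then have "x mod int p = y mod int p" by (simp add: mod_eq_dvd_iff mod_eq_0_iff_dvd)
    then show False using that assms by simp
  qed
  have ne: "(x - t) mod int p \<noteq> x" if "t \<in> {1..int p - 1}" for t
  proof
    assume "(x - t) mod int p = x"
    then have "(x - t) mod int p = x mod int p" using assms by simp
    then have "int p dvd t" by (simp add: mod_eq_dvd_iff)
    then show False using that by (auto dest: zdvd_imp_le)
  qed
  have mem: "z mod int p \<in> {0..int p - 1}" for z using assms(1) by simp
  have pos: "{1..int p - 1} = {0..int p - 1} - {0}" by auto
  show "\<forall>y\<in>{0..int p - 1} - {x}. (x - (x - y) mod int p) mod int p = y"
    "\<forall>t\<in>{1..int p - 1}. (x - (x - t) mod int p) mod int p = t"
    by (simp_all add: inv)
  show "(\<lambda>y. (x - y) mod int p) ` ({0..int p - 1} - {x}) \<subseteq> {1..int p - 1}"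
  proof (rule image_subsetI)
    fix y assume "y \<in> {0..int p - 1} - {x}"
    then have "(x - y) mod int p \<noteq> 0" by (intro nz) simp_all
    then show "(x - y) mod int p \<in> {1..int p - 1}"
      unfolding pos using mem[of "x - y"] by (intro DiffI) simp_all
  qed
  show "(\<lambda>t. (x - t) mod int p) ` {1..int p - 1} \<subseteq> {0..int p - 1} - {x}"
  proof (rule image_subsetI)
    fix t assume "t \<in> {1..int p - 1}"
    then have "(x - t) mod int p \<noteq> x" by (rule ne)
    then show "(x - t) mod int p \<in> {0..int p - 1} - {x}"
      using mem[of "x - t"] by (intro DiffI) simp_all
  qed
qed

lemma frame_angles_harmonic_frame:
  fixes g :: "'m::finite \<Rightarrow> int"
  assumes "p > 0" "bij_betw g UNIV S"
  shows "frame_angles {0..int p - 1} (harmonic_frame p g) =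
           (\<lambda>t. cmod (char_sum p S t) / real CARD('m)) ` {1..int p - 1}"
proof -
  let ?C = "{0..int p - 1}" and ?\<alpha> = "\<lambda>t. cmod (char_sum p S t) / real CARD('m)"
  have "frame_angles ?C (harmonic_frame p g) =
      (\<Union>x\<in>?C. ?\<alpha> ` (\<lambda>y. (x - y) mod int p) ` (?C - {x}))"
    unfolding frame_angles_def cmod_herm_prod_harmonic_frame[OF assms] image_image by blast
  also have "\<dots> = (\<Union>x\<in>?C. ?\<alpha> ` {1..int p - 1})"
    using bij_betw_imp_surj_on[OF bij_betw_residue_diff[OF assms(1)]] by simp
  also have "\<dots> = ?\<alpha> ` {1..int p - 1}" using assms(1) by auto
  finally show ?thesis .
qed

lemma has_angle_multiplicity_harmonic_frame:
  fixes g :: "'m::finite \<Rightarrow> int"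
  assumes "p > 0" "bij_betw g UNIV S"
    and "T \<noteq> {}" "T = {t \<in> {1..int p - 1}. cmod (char_sum p S t) / real CARD('m) = \<alpha>}"
  shows "has_angle_multiplicity {0..int p - 1} (harmonic_frame p g) \<alpha> (card T)"
proof -
  let ?C = "{0..int p - 1}" and ?\<alpha> = "\<lambda>t. cmod (char_sum p S t) / real CARD('m)"
  have "card {y \<in> ?C. y \<noteq> x \<and> ?\<alpha> ((x - y) mod int p) = \<alpha>} = card T" if x: "x \<in> ?C" for x
  proof (rule bij_betw_same_card)
    have "bij_betw (\<lambda>y. (x - y) mod int p)
        {y \<in> ?C - {x}. ?\<alpha> ((x - y) mod int p) = \<alpha>} {t \<in> {1..int p - 1}. ?\<alpha> t = \<alpha>}"
      using bij_betw_residue_diff[OF assms(1) x] by (rule bij_betw_Collect) simp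
    then show "bij_betw (\<lambda>y. (x - y) mod int p)
        {y \<in> ?C. y \<noteq> x \<and> ?\<alpha> ((x - y) mod int p) = \<alpha>} T"
      unfolding assms(4) by (simp add: conj_assoc)
  qed
  moreover have "\<alpha> \<in> frame_angles ?C (harmonic_frame p g)"
    unfolding frame_angles_harmonic_frame[OF assms(1,2)] using assms(3,4) by auto
  ultimately show ?thesis
    unfolding has_angle_multiplicity_def cmod_herm_prod_harmonic_frame[OF assms(1,2)] by blast
qed


section \<open>The classification\<close>

text \<open>
  The case distinction is on \<open>l = \<mu>\<close> rather than on \<open>p\<close> modulo \<open>4\<close>, since equality of the
  parameters alone makes the frame equiangular.
\<close>

theorem theorem4p33:
  fixes p m l \<mu> :: nat
    and S :: "int set"
    and g :: "'m::finite \<Rightarrow> int"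
    and F :: "int \<Rightarrow> complex^'m"
  assumes "prime p" and "odd p"
    and "gaussian_difference_set p m l \<mu> S"
    and "bij_betw g UNIV S"
    and "F = harmonic_frame p g"
  shows
    "([p = 3] (mod 4) \<and> difference_set p m l S \<and>
        equiangular (carrier (Zmod p)) F \<and> tight_frame (carrier (Zmod p)) F) \<or>
     ([p = 1] (mod 4) \<and> difference_set p m l S \<and>
        equiangular (carrier (Zmod p)) F \<and> tight_frame (carrier (Zmod p)) F) \<or>
     ([p = 1] (mod 4) \<and>
        biangular (carrier (Zmod p)) F \<and> tight_frame (carrier (Zmod p)) F \<and>
        (\<exists>\<alpha>1 \<alpha>2 :: real. \<exists>\<tau>1 \<tau>2 :: nat.
           frame_angles (carrier (Zmod p)) F = {\<alpha>1, \<alpha>2} \<and>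
           has_angle_multiplicity (carrier (Zmod p)) F \<alpha>1 \<tau>1 \<and>
           has_angle_multiplicity (carrier (Zmod p)) F \<alpha>2 \<tau>2 \<and>
           \<alpha>1 = 1 / real m *
                sqrt ((real m - real l) + (real l - real \<mu>) * ((1 + sqrt (real p)) / 2)) \<and>
           \<alpha>2 = 1 / real m *
                sqrt ((real m - real l) + (real l - real \<mu>) * ((1 - sqrt (real p)) / 2)) \<and>
           real \<tau>1 = (real p - 1) / 2 \<and> real \<tau>2 = (real p - 1) / 2))"
proof -
  have p: "p > 1" using assms(1) prime_gt_1_nat by blast
  then have p0: "p > 0" by simp
  note C = Zmod_simps(1)[OF p]
  let ?C = "{0..int p - 1}" and ?U = "{1..int p - 1}"
  let ?R = "nonzero_squares p" and ?N = "nonsquares p"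
  note U = carrier_partition(1,2)[OF assms(1)]
  note spec = gaussian_difference_set_spectrum[OF assms(1-3)]
  have S: "S \<subseteq> ?C" "card S = m"
    using assms(3) unfolding gaussian_difference_set_def C by auto
  have m: "CARD('m) = m" using bij_betw_same_card[OF assms(4)] S(2) by simp
  have "CARD('m) > 0" by simp
  then have m0: "real m > 0" unfolding m by simp
  define \<alpha> where "\<alpha> t = cmod (char_sum p S t) / real m" for t
  have tight: "tight_frame (carrier (Zmod p)) F"
    unfolding C assms(5)
    using assms(4) S(1) p by (intro tight_frame_harmonic_frame) (auto simp: bij_betw_def)
  have unit: "unit_norm (carrier (Zmod p)) F"
    unfolding assms(5) by (rule unit_norm_harmonic_frame)
  have angles: "frame_angles (carrier (Zmod p)) F = \<alpha> ` ?U"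
    unfolding C assms(5) frame_angles_harmonic_frame[OF p0 assms(4)] m \<alpha>_def ..
  have mod4: "[p = 1] (mod 4) \<or> [p = 3] (mod 4)"
  proof -
    have "p mod 4 = 1 \<or> p mod 4 = 3" using assms(2) by presburger
    then show ?thesis by (simp add: cong_def)
  qed
  show ?thesis
  proof (cases "l = \<mu>")
    case True
    have "difference_set p m l S"
      using gaussian_difference_set_eq_params[OF assms(1)] assms(3) True by simp
    moreover have "equiangular (carrier (Zmod p)) F"
    proof -
      have sq: "(cmod (char_sum p S t))\<^sup>2 = real m - real l" if "t \<in> ?U" for t
      proof -
        from that have "t \<in> ?R \<or> t \<in> ?N" unfolding U(1)[symmetric] by (rule UnE) simp_all
        then have "complex_of_real ((cmod (char_sum p S t))\<^sup>2) = complex_of_real (real m - real l)"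
        proof
          assume t: "t \<in> ?R"
          show ?thesis unfolding spec(1)[OF t] True by (simp add: algebra_simps)
        next
          assume t: "t \<in> ?N"
          show ?thesis unfolding spec(2)[OF t] True by (simp add: algebra_simps)
        qed
        then show ?thesis by (simp only: of_real_eq_iff)
      qed
      have "\<alpha> t = sqrt (real m - real l) / real m" if "t \<in> ?U" for t
        using real_sqrt_unique[OF sq[OF that] norm_ge_zero] by (simp add: \<alpha>_def)
      then have "\<alpha> ` ?U = (\<lambda>_. sqrt (real m - real l) / real m) ` ?U"
        by (rule image_cong[OF refl])
      moreover have "?U \<noteq> {}" using p by simp
      ultimately have "\<alpha> ` ?U = {sqrt (real m - real l) / real m}" by (simp only: image_constant_conv if_False)
      then show ?thesis unfolding equiangular_def angles using unit by simp
    qed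
    ultimately show ?thesis using mod4 tight by blast
  next
    case False
    have p1: "[p = 1] (mod 4)"
      using gaussian_difference_set_3_mod_4[OF assms(1,2) _ assms(3)] False by blast
    obtain \<eta> where \<eta>: "gauss_period p = complex_of_real \<eta>"
      and sign: "2 * \<eta> + 1 = sqrt (real p) \<or> 2 * \<eta> + 1 = - sqrt (real p)"
      using gauss_period_real[OF assms(1) p1] .
    \<comment> \<open>If \<open>e = 2 * \<eta> + 1\<close> is the Gauss sum, then \<open>A e\<close> is the angle at the squares and
      \<open>A (- e)\<close> the angle at the nonsquares.\<close>
    define A where "A e = 1 / real m *
      sqrt ((real m - real l) + (real l - real \<mu>) * ((1 + e) / 2))" for e
    have \<alpha>R: "\<alpha> t = A (2 * \<eta> + 1)" if "t \<in> ?R" for t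
    proof -
      have "complex_of_real ((cmod (char_sum p S t))\<^sup>2) =
          complex_of_real ((real m - real l) + (real l - real \<mu>) * ((1 + (2 * \<eta> + 1)) / 2))"
        unfolding spec(1)[OF that] \<eta> by (simp add: field_simps)
      then have "(cmod (char_sum p S t))\<^sup>2 =
          (real m - real l) + (real l - real \<mu>) * ((1 + (2 * \<eta> + 1)) / 2)"
        by (simp only: of_real_eq_iff)
      from real_sqrt_unique[OF this norm_ge_zero] show ?thesis
        unfolding \<alpha>_def A_def by (simp only: mult_1 times_divide_eq_left)
    qed
    have \<alpha>N: "\<alpha> t = A (- (2 * \<eta> + 1))" if "t \<in> ?N" for t
    proof -
      have "complex_of_real ((cmod (char_sum p S t))\<^sup>2) =
          complex_of_real ((real m - real l) + (real l - real \<mu>) * ((1 + - (2 * \<eta> + 1)) / 2))"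
        unfolding spec(2)[OF that] \<eta> by (simp add: field_simps)
      then have "(cmod (char_sum p S t))\<^sup>2 =
          (real m - real l) + (real l - real \<mu>) * ((1 + - (2 * \<eta> + 1)) / 2)"
        by (simp only: of_real_eq_iff)
      from real_sqrt_unique[OF this norm_ge_zero] show ?thesis
        unfolding \<alpha>_def A_def by (simp only: mult_1 times_divide_eq_left)
    qed
    \<comment> \<open>The radicand is affine in \<open>e\<close> of nonzero slope, and \<open>sqrt\<close>, being odd, is injective on
      all reals.\<close>
    have "inj A"
      using False m0 by (auto simp: inj_def A_def)
    have ne: "A (2 * \<eta> + 1) \<noteq> A (- (2 * \<eta> + 1))"
    proof -
      have "sqrt (real p) > 0" using p by simp
      then have "2 * \<eta> + 1 \<noteq> - (2 * \<eta> + 1)" using sign by linarith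
      then show ?thesis unfolding inj_eq[OF \<open>inj A\<close>] .
    qed
    have h: "real ((p - 1) div 2) = (real p - 1) / 2" "(p - 1) div 2 > 0"
      using assms(2) p by (auto elim!: oddE)
    have cards: "card ?R = (p - 1) div 2" "card ?N = (p - 1) div 2"
      using card_nonzero_squares card_nonsquares assms by auto
    have nonempty: "?R \<noteq> {}" "?N \<noteq> {}" using cards h(2) by auto
    have "\<alpha> ` ?U = {A (2 * \<eta> + 1), A (- (2 * \<eta> + 1))}"
      unfolding U(1)[symmetric] image_Un using nonempty \<alpha>R \<alpha>N by auto
    then have ang: "frame_angles (carrier (Zmod p)) F = {A (2 * \<eta> + 1), A (- (2 * \<eta> + 1))}"
      unfolding angles .
    have multR: "has_angle_multiplicity (carrier (Zmod p)) F (A (2 * \<eta> + 1)) ((p - 1) div 2)"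
    proof -
      have "?R = {t \<in> ?U. \<alpha> t = A (2 * \<eta> + 1)}"
        unfolding U(1)[symmetric] using \<alpha>R \<alpha>N ne by auto
      then show ?thesis
        using has_angle_multiplicity_harmonic_frame[OF p0 assms(4) nonempty(1)]
        unfolding C assms(5) cards m \<alpha>_def by blast
    qed
    have multN: "has_angle_multiplicity (carrier (Zmod p)) F (A (- (2 * \<eta> + 1))) ((p - 1) div 2)"
    proof -
      have "?N = {t \<in> ?U. \<alpha> t = A (- (2 * \<eta> + 1))}"
        unfolding U(1)[symmetric] using \<alpha>R \<alpha>N ne by auto
      then show ?thesis
        using has_angle_multiplicity_harmonic_frame[OF p0 assms(4) nonempty(2)]
        unfolding C assms(5) cards m \<alpha>_def by blast
    qed
    have "frame_angles (carrier (Zmod p)) F = {A (sqrt p), A (- sqrt p)} \<and>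
        has_angle_multiplicity (carrier (Zmod p)) F (A (sqrt p)) ((p - 1) div 2) \<and>
        has_angle_multiplicity (carrier (Zmod p)) F (A (- sqrt p)) ((p - 1) div 2)"
      using sign
    \<comment> \<open>For a negative Gauss sum the squares carry the second angle and the nonsquares the first.\<close>
    proof
      assume "2 * \<eta> + 1 = sqrt p"
      then show ?thesis using ang multR multN by simp
    next
      assume "2 * \<eta> + 1 = - sqrt p"
      then show ?thesis using ang multR multN by (simp add: insert_commute)
    qed
    moreover have "biangular (carrier (Zmod p)) F"
      unfolding biangular_def ang using unit ne by simp
    moreover have "A (sqrt p) = 1 / real m *
        sqrt ((real m - real l) + (real l - real \<mu>) * ((1 + sqrt (real p)) / 2))"
      "A (- sqrt p) = 1 / real m *
        sqrt ((real m - real l) + (real l - real \<mu>) * ((1 - sqrt (real p)) / 2))"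
      by (simp_all add: A_def)
    ultimately show ?thesis using p1 tight h(1) by blast
  qed
qed

end
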